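(* Let $\nu:\mathbb{R}^d\to\mathbb{R}$ belong to the class $\Phi^{(d)}$ (see context). A non-zero centered $d$-dimensional random vector $\xi$ belongs to the space $\Phi^{(d)}(\nu)$ if and only if there exists a constant $C>0$ such that for all $x\in\mathbb{R}^d$ with non-negative coordinates $$T_\xi(x)\le\exp\left(-\nu^*(Cx)\right).$$
   Context: The class $\Phi^{(d)}$ consists of the even ($\nu(-\mu)=\nu(\mu)$), strictly convex, twice continuously differentiable functions $\nu:\mathbb{R}^d\to\mathbb{R}$ taking positive values at non-zero arguments and satisfying: (A) $\nu(0)=0$, $\operatorname{grad}\nu(0)=0$, $\lim_{r\to\infty}\min_{|\mu|_2\ge r}|\operatorname{grad}\nu(\mu)|_2=\infty$; (B) $\inf_{\mu\in\mathbb{R}^d}\lambda_{\min}\left[\partial^2\nu/\partial\mu_j\partial\mu_k\right]>0$, where $\lambda_{\min}$ is the smallest eigenvalue; (C) $\nu(\mu(k)e(k))\le\nu(\mu)$ for all $\mu=(\mu(1),\dots,\mu(d))\in\mathbb{R}^d$ and all $k$, where $e(k)$ is the $k$-th standard basis vector. A centered random vector $\eta$ belongs to $\Phi^{(d)}(\nu)$ if there is a constant $\tau\ge0$ such that $\mathbf{E}\exp((\mu,\eta))\le\exp(\nu(\tau\mu))$ for all $\mu\in\mathbb{R}^d$. The Young–Fenchel transform is $\nu^*(x)=\sup_{\mu\in\mathbb{R}^d}((x,\mu)-\nu(\mu))$. For $x=(x_1,\dots,x_d)$ with $x_i\ge0$, the multidimensional tail function is $$T_\xi(x)=\max_{\pm}\mathbf{P}\left(\pm\xi(1)\ge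 x_1,\ \pm\xi(2)\ge x_2,\dots,\pm\xi(d)\ge x_d\right),$$ the maximum being over all $2^d$ combinations of signs. *)

theory Defs
  imports "HOL-Probability.Probability"
begin

definition grad :: "(real ^ 'n \<Rightarrow> real) \<Rightarrow> real ^ 'n \<Rightarrow> real ^ 'n" where
  "grad f \<mu> = (\<chi> j. frechet_derivative f (at \<mu>) (axis j 1))"

definition hessian :: "(real ^ 'n \<Rightarrow> real) \<Rightarrow> real ^ 'n \<Rightarrow> real ^ 'n ^ 'n" where
  "hessian f \<mu> = jacobian (grad f) (at \<mu>)"

definition twice_cont_differentiable :: "(real ^ 'n \<Rightarrow> real) \<Rightarrow> bool" where
  "twice_cont_differentiable f \<longleftrightarrow>
     f differentiable_on UNIV \<and> grad f differentiable_on UNIV \<and> continuous_on UNIV (hessian f)"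

definition strictly_convex :: "('a::real_vector \<Rightarrow> real) \<Rightarrow> bool" where
  "strictly_convex f \<longleftrightarrow>
     (\<forall>x y t. x \<noteq> y \<longrightarrow> 0 < t \<longrightarrow> t < 1 \<longrightarrow>
        f ((1 - t) *\<^sub>R x + t *\<^sub>R y) < (1 - t) * f x + t * f y)"

(* Only applied to Hessians of twice continuously differentiable functions, which are symmetric,
   so that a least real eigenvalue exists. *)
definition lambda_min :: "real ^ 'n ^ 'n \<Rightarrow> real" where
  "lambda_min A = (LEAST l. \<exists>v. v \<noteq> 0 \<and> A *v v = l *\<^sub>R v)"

(* In (A) the minimum over the closed set of all mu with norm at least r is written as an infimum
   of non-negative reals; it is attained, since grad nu is continuous and its norm tends to
   infinity.  In (B) the infimum is taken in the extended reals, so that it is meaningful without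
   first knowing that the eigenvalues are bounded below. *)
definition Phi_class :: "(real ^ 'n \<Rightarrow> real) \<Rightarrow> bool" where
  "Phi_class \<nu> \<longleftrightarrow>
     (\<forall>\<mu>. \<nu> (- \<mu>) = \<nu> \<mu>) \<and>
     strictly_convex \<nu> \<and>
     twice_cont_differentiable \<nu> \<and>
     (\<forall>\<mu>. \<mu> \<noteq> 0 \<longrightarrow> \<nu> \<mu> > 0) \<and>
     \<comment> \<open>(A)\<close>
     \<nu> 0 = 0 \<and> grad \<nu> 0 = 0 \<and>
     filterlim (\<lambda>r. INF \<mu>\<in>{\<mu>. norm \<mu> \<ge> r}. norm (grad \<nu> \<mu>)) at_top at_top \<and>
     \<comment> \<open>(B)\<close>
     (INF \<mu>. ereal (lambda_min (hessian \<nu> \<mu>))) > 0 \<and>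
     \<comment> \<open>(C)\<close>
     (\<forall>\<mu> k. \<nu> ((\<mu> $ k) *\<^sub>R axis k 1) \<le> \<nu> \<mu>)"

definition centered :: "'a measure \<Rightarrow> ('a \<Rightarrow> real ^ 'n) \<Rightarrow> bool" where
  "centered M \<eta> \<longleftrightarrow> integrable M \<eta> \<and> (\<integral>\<omega>. \<eta> \<omega> \<partial>M) = 0"

(* The Bochner integral of a non-integrable function is 0, so finiteness of the exponential
   moment has to be stated separately. *)
definition in_Phi_space :: "'a measure \<Rightarrow> (real ^ 'n \<Rightarrow> real) \<Rightarrow> ('a \<Rightarrow> real ^ 'n) \<Rightarrow> bool" where
  "in_Phi_space M \<nu> \<eta> \<longleftrightarrow>
     centered M \<eta> \<and>
     (\<exists>\<tau>\<ge>0. \<forall>\<mu>. integrable M (\<lambda>\<omega>. exp (\<mu> \<bullet> \<eta> \<omega>)) \<and>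
        (\<integral>\<omega>. exp (\<mu> \<bullet> \<eta> \<omega>) \<partial>M) \<le> exp (\<nu> (\<tau> *\<^sub>R \<mu>)))"

(* A real supremum; for nu in Phi_class the set is bounded above, see bdd_above_Young_Fenchel. *)
definition Young_Fenchel :: "(real ^ 'n \<Rightarrow> real) \<Rightarrow> real ^ 'n \<Rightarrow> real" where
  "Young_Fenchel \<nu> x = (SUP \<mu>. x \<bullet> \<mu> - \<nu> \<mu>)"

(* The maximum over all sign vectors s, i.e. the signs are chosen independently for each
   coordinate. *)
definition multi_tail :: "'a measure \<Rightarrow> ('a \<Rightarrow> real ^ 'n) \<Rightarrow> real ^ 'n \<Rightarrow> real" where
  "multi_tail M \<xi> x =
     Max ((\<lambda>s. measure M {\<omega> \<in> space M. \<forall>i. s i * \<xi> \<omega> $ i \<ge> x $ i}) ` (UNIV \<rightarrow> {1, -1}))"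

lemma finite_sign_vectors: "finite ((UNIV :: 'n::finite set) \<rightarrow> {1, -1 :: real})"
  using finite_PiE[of "UNIV :: 'n set" "\<lambda>_. {1, -1 :: real}"] by (simp add: PiE_UNIV_domain Pi_def)

lemma GDERIV_grad:
  fixes f :: "real ^ 'n \<Rightarrow> real"
  assumes "f differentiable (at \<mu>)"
  shows "GDERIV f \<mu> :> grad f \<mu>"
proof -
  define D where "D = frechet_derivative f (at \<mu>)"
  have D: "(f has_derivative D) (at \<mu>)"
    using assms unfolding D_def by (simp add: frechet_derivative_works)
  then interpret linear D by (rule has_derivative_linear)
  have "D h = h \<bullet> grad f \<mu>" for h
  proof -
    have "D h = D (\<Sum>j\<in>UNIV. h $ j *\<^sub>R axis j 1)"
      using basis_expansion[of h] by (simp add: scalar_mult_eq_scaleR)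
    also have "\<dots> = (\<Sum>j\<in>UNIV. h $ j * D (axis j 1))"
      by (simp add: sum scaleR)
    finally show ?thesis by (simp add: grad_def inner_vec_def D_def)
  qed
  then have "D = (\<lambda>h. h \<bullet> grad f \<mu>)" by auto
  with D show ?thesis by (simp add: gderiv_def)
qed

lemma bdd_above_Young_Fenchel:
  fixes \<nu> :: "real ^ 'n \<Rightarrow> real"
  assumes \<nu>: "Phi_class \<nu>"
  shows "bdd_above (range (\<lambda>\<mu>. x \<bullet> \<mu> - \<nu> \<mu>))"
proof -
  have diff: "\<nu> differentiable (at \<mu>)" for \<mu>
    using \<nu> by (simp add: Phi_class_def twice_cont_differentiable_def differentiable_on_def)
  have cont: "continuous_on UNIV \<nu>"
    using diff by (simp add: continuous_at_imp_continuous_on differentiable_imp_continuous_within)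
  have \<nu>0: "\<nu> 0 = 0" and nonneg: "\<nu> \<mu> \<ge> 0" for \<mu>
    using \<nu> by (cases "\<mu> = 0"; force simp: Phi_class_def)+
  have "\<forall>\<^sub>F r in at_top. (INF \<mu>\<in>{\<mu>. norm \<mu> \<ge> r}. norm (grad \<nu> \<mu>)) > 3 * norm x"
    using \<nu> unfolding Phi_class_def filterlim_at_top_dense by blast
  then obtain R where R: "(INF \<mu>\<in>{\<mu>. norm \<mu> \<ge> R}. norm (grad \<nu> \<mu>)) > 3 * norm x"
    by (meson eventually_at_top_linorder order_refl)
  have R': "norm \<mu> \<le> R" if "norm (grad \<nu> \<mu>) \<le> 3 * norm x" for \<mu>
  proof (rule ccontr)
    assume "\<not> norm \<mu> \<le> R"
    then have "(INF \<mu>\<in>{\<mu>. norm \<mu> \<ge> R}. norm (grad \<nu> \<mu>)) \<le> norm (grad \<nu> \<mu>)"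
      by (intro cINF_lower bdd_belowI2[of _ 0]) auto
    with R that show False by linarith
  qed
  have key: "x \<bullet> \<mu> - \<nu> \<mu> \<le> norm x * R + \<epsilon> * (norm \<mu>)\<^sup>2" if \<epsilon>: "\<epsilon> > 0" for \<epsilon> \<mu>
  proof -
    define F where "F = (\<lambda>m. \<nu> m - x \<bullet> m + \<epsilon> * (m \<bullet> m))"
    have "continuous_on (cball 0 (norm x / \<epsilon>)) F"
      unfolding F_def by (intro continuous_intros continuous_on_subset[OF cont]) auto
    then obtain m where m: "\<And>y. y \<in> cball 0 (norm x / \<epsilon>) \<Longrightarrow> F m \<le> F y" "m \<in> cball 0 (norm x / \<epsilon>)"
      using continuous_attains_inf[of "cball 0 (norm x / \<epsilon>)" F] \<epsilon>
      by (metis cball_eq_empty compact_cball divide_nonneg_pos norm_ge_zero not_less)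
    have F0: "F 0 = 0" by (simp add: F_def \<nu>0)
    have "F m \<le> F 0" using m(1)[of 0] \<epsilon> by simp
    have min: "F m \<le> F y" for y
    proof (cases "y \<in> cball 0 (norm x / \<epsilon>)")
      case False
      then have "norm x \<le> \<epsilon> * norm y" using \<epsilon> by (simp add: field_simps)
      then have "norm x * norm y \<le> \<epsilon> * norm y * norm y" by (intro mult_right_mono) auto
      moreover have "x \<bullet> y \<le> norm x * norm y" by (rule norm_cauchy_schwarz)
      ultimately have "F y \<ge> 0"
        using nonneg[of y] by (simp add: F_def dot_square_norm power2_eq_square mult.assoc)
      with \<open>F m \<le> F 0\<close> F0 show ?thesis by linarith
    qed (use m(1) in blast)
    have "(\<nu> has_derivative (\<lambda>h. h \<bullet> grad \<nu> m)) (at m)"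
      using GDERIV_grad[OF diff] by (simp add: gderiv_def)
    then have "(F has_derivative (\<lambda>h. h \<bullet> grad \<nu> m - x \<bullet> h + \<epsilon> * (m \<bullet> h + h \<bullet> m))) (at m)"
      unfolding F_def by (auto intro!: derivative_eq_intros)
    then have "(\<lambda>h. h \<bullet> grad \<nu> m - x \<bullet> h + \<epsilon> * (m \<bullet> h + h \<bullet> m)) = (\<lambda>h. 0)"
      using min by (intro differential_zero_maxmin[of m UNIV F]) auto
    then have "h \<bullet> grad \<nu> m - x \<bullet> h + \<epsilon> * (m \<bullet> h + h \<bullet> m) = 0" for h by meson
    then have "h \<bullet> (grad \<nu> m - x + (2 * \<epsilon>) *\<^sub>R m) = 0" for h
      by (simp add: inner_diff_right inner_add_right inner_commute algebra_simps)
    then have "grad \<nu> m - x + (2 * \<epsilon>) *\<^sub>R m = 0" by (meson inner_eq_zero_iff)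
    then have "grad \<nu> m = x - (2 * \<epsilon>) *\<^sub>R m" by (simp add: algebra_simps)
    then have "norm (grad \<nu> m) \<le> norm x + 2 * \<epsilon> * norm m"
      using norm_triangle_ineq4[of x "(2 * \<epsilon>) *\<^sub>R m"] \<epsilon> by simp
    moreover have "\<epsilon> * norm m \<le> norm x" using m(2) \<epsilon> by (simp add: field_simps)
    ultimately have "norm m \<le> R" by (intro R') linarith
    then have "norm x * norm m \<le> norm x * R" by (intro mult_left_mono) auto
    moreover have "x \<bullet> m \<le> norm x * norm m" by (rule norm_cauchy_schwarz)
    moreover have "\<epsilon> * (m \<bullet> m) \<ge> 0" using \<epsilon> by simp
    ultimately have "F m \<ge> - (norm x * R)" using nonneg[of m] by (simp add: F_def)
    with min[of \<mu>] show ?thesis by (simp add: F_def dot_square_norm)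
  qed
  have "x \<bullet> \<mu> - \<nu> \<mu> \<le> norm x * R" for \<mu>
  proof (rule field_le_epsilon)
    fix e :: real assume e: "e > 0"
    have "e / ((norm \<mu>)\<^sup>2 + 1) * (norm \<mu>)\<^sup>2 \<le> e"
      using e by (simp add: field_simps add_pos_nonneg)
    moreover have "e / ((norm \<mu>)\<^sup>2 + 1) > 0" using e by (simp add: add_nonneg_pos)
    ultimately show "x \<bullet> \<mu> - \<nu> \<mu> \<le> norm x * R + e"
      using key[of "e / ((norm \<mu>)\<^sup>2 + 1)" \<mu>] by linarith
  qed
  then show ?thesis by (auto simp: bdd_above_def)
qed

end

theory Submission
  imports Defs
begin

text \<open>
Convexity and (C) compare \<open>\<nu>\<close> with its restrictions to the coordinate axes:
\<open>(\<Sum>k. \<nu> (\<mu>\<^sub>k e\<^sub>k)) / d \<le> \<nu> \<mu> \<le> (\<Sum>k. \<nu> (d \<mu>\<^sub>k e\<^sub>k)) / d\<close>. Since the axis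
values do not depend on the signs of the coordinates, Chernoff's bound in the direction
\<open>s\<^sub>k |\<mu>\<^sub>k| / (d \<tau>)\<close> gives the tail estimate with \<open>C = 1 / (d \<tau>)\<close>, although \<open>\<nu>\<close> itself is
only invariant under the simultaneous change of all signs.

Conversely, the tail estimate on the axes gives \<open>P (exp (l |\<xi>\<^sub>k|) \<ge> y) \<le> B / y\<^sup>2\<close> with
\<open>B\<close> proportional to \<open>exp (\<nu> ((2 l / C) e\<^sub>k))\<close>, hence \<open>E exp (\<mu> \<bullet> \<xi>) \<le> K exp (\<nu> (\<tau> \<mu>))\<close>. The constant
\<open>K\<close> is absorbed by enlarging \<open>\<tau>\<close>: away from the origin by convexity, near the origin because \<open>\<xi>\<close>
is centered, so that \<open>E exp (\<mu> \<bullet> \<xi>) \<le> exp (E\<^sub>2 |\<mu>|\<^sup>2)\<close>, while (B) makes \<open>\<nu>\<close> grow at least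
quadratically there.
\<close>

section \<open>Second-order expansion and symmetry of the second derivative\<close>

text \<open>
The term \<open>(b \<bullet> H a - a \<bullet> H b) / 2\<close> is the asymmetry of \<open>H\<close>. Setting \<open>a = 0\<close> gives Taylor's formula;
since then all other terms are \<open>o(r\<^sup>2)\<close>, \<open>H\<close> is symmetric, and this needs no continuity of the
second derivative.
\<close>
lemma GDERIV_second_order_remainder:
  fixes f :: "'a::real_inner \<Rightarrow> real" and g H :: "'a \<Rightarrow> 'a"
  assumes f: "\<And>x. GDERIV f x :> g x" and g: "(g has_derivative H) (at p)" and e: "e > 0"
  obtains d where "d > 0"
    "\<And>a b r. norm a \<le> r \<Longrightarrow> norm b \<le> r \<Longrightarrow> r < d \<Longrightarrow>
      \<bar>(f (p + b) - b \<bullet> g p - b \<bullet> H b / 2) - (f (p + a) - a \<bullet> g p - a \<bullet> H a / 2)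
        - (b \<bullet> H a - a \<bullet> H b) / 2\<bar> \<le> e * r * norm (b - a)"
proof -
  obtain d where d: "d > 0" "\<And>y. norm (y - p) < d \<Longrightarrow> norm (g y - g p - H (y - p)) \<le> e * norm (y - p)"
    using g e unfolding has_derivative_within_alt by (metis UNIV_I)
  interpret H: bounded_linear H using g by (rule has_derivative_bounded_linear)
  have main: "\<bar>(f (p + b) - b \<bullet> g p - b \<bullet> H b / 2) - (f (p + a) - a \<bullet> g p - a \<bullet> H a / 2)
        - (b \<bullet> H a - a \<bullet> H b) / 2\<bar> \<le> e * r * norm (b - a)"
    if ab: "norm a \<le> r" "norm b \<le> r" "r < d" for a b r
  proof -
    \<comment> \<open>The mean value theorem is applied to \<open>f\<close> minus its second-order
      polynomial, along the segment from \<open>a\<close> to \<open>b\<close>.\<close>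
    define w where "w t = a + t *\<^sub>R (b - a)" for t :: real
    define F where "F t = f (p + w t) - w t \<bullet> g p - w t \<bullet> H (w t) / 2" for t
    define F' where "F' t = (\<lambda>h. h * ((b - a) \<bullet> (g (p + w t) - g p)
      - ((b - a) \<bullet> H (w t) + w t \<bullet> H (b - a)) / 2))" for t
    have w: "(w has_derivative (\<lambda>h. h *\<^sub>R (b - a))) (at t within S)" for t S
      unfolding w_def by (auto intro!: derivative_eq_intros)
    have fw: "((\<lambda>t. f (p + w t)) has_derivative (\<lambda>h. (h *\<^sub>R (b - a)) \<bullet> g (p + w t))) (at t within S)" for t S
    proof -
      have "((\<lambda>t. p + w t) has_derivative (\<lambda>h. h *\<^sub>R (b - a))) (at t within S)"
        using w by (auto intro!: derivative_eq_intros)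
      then show ?thesis using f unfolding gderiv_def
        by (rule has_derivative_compose)
    qed
    have "(F has_derivative F' t) (at t within S)" for t S
      unfolding F_def F'_def
      by (rule derivative_eq_intros fw w H.has_derivative[OF w] refl | simp)+
         (simp add: H.scaleR H.diff algebra_simps inner_simps)
    from mvt_simple[OF zero_less_one this] obtain t where
      t: "t \<in> {0<..<1}" "F 1 - F 0 = F' t (1 - 0)" by blast
    have "norm (w t) \<le> r"
    proof -
      have "w t = (1 - t) *\<^sub>R a + t *\<^sub>R b" by (simp add: w_def algebra_simps)
      then have "norm (w t) \<le> (1 - t) * norm a + t * norm b"
        using norm_triangle_ineq[of "(1 - t) *\<^sub>R a" "t *\<^sub>R b"] t by simp
      also have "\<dots> \<le> r" using t ab by (intro convex_bound_le) auto
      finally show ?thesis .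
    qed
    then have rem: "norm (g (p + w t) - g p - H (w t)) \<le> e * r"
      using d(2)[of "p + w t"] ab e
      by simp (meson mult_le_cancel_left_pos order_trans)
    \<comment> \<open>\<open>F'\<close> contains the symmetrised form; trading it for
      \<open>(b - a) \<bullet> H (w t)\<close> costs
      \<open>((b - a) \<bullet> H (w t) - w t \<bullet> H (b - a)) / 2\<close>. The part of this
      that depends on \<open>t\<close> cancels, leaving the asymmetry between \<open>a\<close> and
      \<open>b\<close>.\<close>
    have "(F 1 - F 0) - (b \<bullet> H a - a \<bullet> H b) / 2 = (b - a) \<bullet> (g (p + w t) - g p - H (w t))"
      unfolding t(2) by (simp add: F'_def w_def H.add H.scaleR H.diff algebra_simps inner_simps)
         (simp add: inner_commute field_simps)
    then have "\<bar>(F 1 - F 0) - (b \<bullet> H a - a \<bullet> H b) / 2\<bar> \<le> norm (b - a) * (e * r)"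
      using Cauchy_Schwarz_ineq2[of "b - a" "g (p + w t) - g p - H (w t)"] rem
        mult_left_mono[OF rem norm_ge_zero[of "b - a"]] by linarith
    then show ?thesis by (simp add: F_def w_def mult.commute mult.left_commute)
  qed
  show ?thesis by (rule that[OF d(1)]) (rule main)
qed

lemma GDERIV_second_order_Taylor:
  fixes f :: "'a::real_inner \<Rightarrow> real" and g H :: "'a \<Rightarrow> 'a"
  assumes f: "\<And>x. GDERIV f x :> g x" and g: "(g has_derivative H) (at p)" and e: "e > 0"
  obtains d where "d > 0"
    "\<And>u. norm u < d \<Longrightarrow> \<bar>f (p + u) - f p - u \<bullet> g p - u \<bullet> H u / 2\<bar> \<le> e * (norm u)\<^sup>2"
proof -
  interpret H: bounded_linear H using g by (rule has_derivative_bounded_linear)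
  obtain d where d: "d > 0" "\<And>a b r. norm a \<le> r \<Longrightarrow> norm b \<le> r \<Longrightarrow> r < d \<Longrightarrow>
      \<bar>(f (p + b) - b \<bullet> g p - b \<bullet> H b / 2) - (f (p + a) - a \<bullet> g p - a \<bullet> H a / 2)
        - (b \<bullet> H a - a \<bullet> H b) / 2\<bar> \<le> e * r * norm (b - a)"
    using GDERIV_second_order_remainder[OF f g e] by metis
  show ?thesis
  proof
    show "d > 0" by fact
    fix u :: 'a assume "norm u < d"
    then show "\<bar>f (p + u) - f p - u \<bullet> g p - u \<bullet> H u / 2\<bar> \<le> e * (norm u)\<^sup>2"
      using d(2)[of 0 "norm u" u] by (simp add: H.zero power2_eq_square algebra_simps)
  qed
qed

lemma GDERIV_second_derivative_symmetric:
  fixes f :: "'a::real_inner \<Rightarrow> real" and g H :: "'a \<Rightarrow> 'a"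
  assumes f: "\<And>x. GDERIV f x :> g x" and g: "(g has_derivative H) (at p)"
  shows "u \<bullet> H v = v \<bullet> H u"
proof -
  interpret H: bounded_linear H using g by (rule has_derivative_bounded_linear)
  define R where "R = norm u + norm v + 1"
  have R: "R > 0" by (simp add: R_def add_nonneg_pos)
  have *: "\<bar>u \<bullet> H v - v \<bullet> H u\<bar> \<le> 8 * R\<^sup>2 * e" if e: "e > 0" for e
  proof -
    obtain d where d: "d > 0" and rem: "\<And>a b r. norm a \<le> r \<Longrightarrow> norm b \<le> r \<Longrightarrow> r < d \<Longrightarrow>
      \<bar>(f (p + b) - b \<bullet> g p - b \<bullet> H b / 2) - (f (p + a) - a \<bullet> g p - a \<bullet> H a / 2)
        - (b \<bullet> H a - a \<bullet> H b) / 2\<bar> \<le> e * r * norm (b - a)"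
      using GDERIV_second_order_remainder[OF f g e] by metis
    \<comment> \<open>\<open>a\<close> and \<open>b\<close> are shrunk copies of \<open>v\<close>
      and \<open>u\<close>, of norm at most \<open>r = d / 2\<close>. The asymmetry and the error
      bound both scale like \<open>s\<^sup>2\<close>, so this factor cancels at the end.\<close>
    define s where "s = d / (2 * R)"
    define r where "r = s * R"
    define a b where "a = s *\<^sub>R v" and "b = s *\<^sub>R u"
    have s: "s > 0" using d R by (simp add: s_def)
    have r: "0 < r" "r < d" using d R by (auto simp: r_def s_def)
    have ab: "norm a \<le> r" "norm b \<le> r"
      using s by (simp_all add: a_def b_def r_def R_def)
    have "norm (b - a) \<le> 2 * r" using ab norm_triangle_ineq4[of b a] by linarith
    then have "e * r * norm (b - a) \<le> e * r * (2 * r)"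
      using e r by (intro mult_left_mono) auto
    moreover have "e * r * norm a \<le> e * r * r" "e * r * norm b \<le> e * r * r"
      using e r ab by (intro mult_left_mono; simp)+
    \<comment> \<open>The pairs \<open>(0, a)\<close> and \<open>(0, b)\<close> carry no asymmetry
      and share the reference value \<open>f p\<close>; comparing them with the pair
      \<open>(a, b)\<close> isolates the asymmetric term.\<close>
    moreover have "\<bar>z\<bar> \<le> A + B + C"
      if "\<bar>y - x - z\<bar> \<le> A" "\<bar>x - w\<bar> \<le> B" "\<bar>y - w\<bar> \<le> C" for x y z w A B C :: real
      using that by linarith
    from this[OF rem[OF ab r(2)]] have "\<bar>(b \<bullet> H a - a \<bullet> H b) / 2\<bar> \<le> e * r * norm (b - a) + e * r * norm a + e * r * norm b"
      using rem[of 0 r a] rem[of 0 r b] ab r by (simp add: H.zero)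
    ultimately have "\<bar>(b \<bullet> H a - a \<bullet> H b) / 2\<bar> \<le> 4 * (e * r * r)"
      by linarith
    also have "(b \<bullet> H a - a \<bullet> H b) / 2 = s\<^sup>2 * ((u \<bullet> H v - v \<bullet> H u) / 2)"
      by (simp add: a_def b_def H.scaleR power2_eq_square algebra_simps)
    also have "4 * (e * r * r) = s\<^sup>2 * (4 * R\<^sup>2 * e)"
      by (simp add: r_def power2_eq_square)
    finally show ?thesis using s by (simp add: abs_mult)
  qed
  have "\<bar>u \<bullet> H v - v \<bullet> H u\<bar> \<le> 0"
  proof (rule field_le_epsilon)
    fix e :: real assume "e > 0"
    then show "\<bar>u \<bullet> H v - v \<bullet> H u\<bar> \<le> 0 + e"
      using *[of "e / (8 * R\<^sup>2)"] R by simp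
  qed
  then show ?thesis by simp
qed

section \<open>Convexity along rays and comparison with the coordinate axes\<close>

lemma Phi_classD:
  assumes "Phi_class \<nu>"
  shows Phi_class_even: "\<nu> (- \<mu>) = \<nu> \<mu>"
    and Phi_class_zero: "\<nu> 0 = 0"
    and Phi_class_nonneg: "\<nu> \<mu> \<ge> 0"
    and Phi_class_axis_le: "\<nu> ((\<mu> $ k) *\<^sub>R axis k 1) \<le> \<nu> \<mu>"
  using assms by (auto simp: Phi_class_def) (metis less_eq_real_def)

lemma Phi_class_axis_abs:
  assumes "Phi_class \<nu>"
  shows "\<nu> (\<bar>c\<bar> *\<^sub>R axis k 1) = \<nu> (c *\<^sub>R axis k 1)"
  using Phi_class_even[OF assms, of "c *\<^sub>R axis k 1"] by (auto simp: abs_if)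

lemma strictly_convex_imp_convex_on:
  assumes "strictly_convex f"
  shows "convex_on UNIV f"
proof (rule convex_onI)
  fix t x y assume "0 < t" "t < (1::real)"
  then show "f ((1 - t) *\<^sub>R x + t *\<^sub>R y) \<le> (1 - t) * f x + t * f y"
    using assms unfolding strictly_convex_def
    by (cases "x = y") (auto simp: less_imp_le simp flip: scaleR_add_left distrib_right)
qed simp

lemma Phi_class_convex_on: "Phi_class \<nu> \<Longrightarrow> convex_on UNIV \<nu>"
  by (simp add: Phi_class_def strictly_convex_imp_convex_on)

lemma Phi_class_scaleR_le:
  assumes "Phi_class \<nu>" "0 \<le> t" "t \<le> 1"
  shows "\<nu> (t *\<^sub>R \<mu>) \<le> t * \<nu> \<mu>"
  using convex_onD[OF Phi_class_convex_on[OF assms(1)], of t 0 \<mu>] assms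
  by (simp add: Phi_class_zero)

lemma Phi_class_scaleR_ge:
  assumes "Phi_class \<nu>" "1 \<le> t"
  shows "t * \<nu> \<mu> \<le> \<nu> (t *\<^sub>R \<mu>)"
  using Phi_class_scaleR_le[OF assms(1), of "1 / t" "t *\<^sub>R \<mu>"] assms(2)
  by (simp add: field_simps)

lemma Phi_class_mono_scaleR:
  assumes "Phi_class \<nu>" "0 \<le> s" "s \<le> t"
  shows "\<nu> (s *\<^sub>R \<mu>) \<le> \<nu> (t *\<^sub>R \<mu>)"
proof (cases "t = 0")
  case False
  then have "\<nu> (s *\<^sub>R \<mu>) \<le> s / t * \<nu> (t *\<^sub>R \<mu>)"
    using Phi_class_scaleR_le[OF assms(1), of "s / t" "t *\<^sub>R \<mu>"] assms by simp
  also have "\<dots> \<le> \<nu> (t *\<^sub>R \<mu>)"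
    using assms False Phi_class_nonneg[OF assms(1)] by (intro mult_left_le_one_le) auto
  finally show ?thesis .
qed (use assms in simp)

text \<open>\<open>\<mu>\<close> is the average of the vectors
  \<open>(CARD('n) * \<mu> $ k) *\<^sub>R axis k 1\<close>, so this is Jensen's inequality.\<close>

lemma Phi_class_le_average_axis:
  fixes \<nu> :: "real ^ 'n \<Rightarrow> real"
  assumes "Phi_class \<nu>"
  shows "\<nu> \<mu> \<le> (\<Sum>k\<in>UNIV. \<nu> ((CARD('n) * \<mu> $ k) *\<^sub>R axis k 1)) / CARD('n)"
proof -
  have "\<nu> (\<Sum>k\<in>UNIV. (1 / CARD('n)) *\<^sub>R (CARD('n) * \<mu> $ k) *\<^sub>R axis k 1)
      \<le> (\<Sum>k\<in>UNIV. (1 / CARD('n)) * \<nu> ((CARD('n) * \<mu> $ k) *\<^sub>R axis k 1))"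
    by (rule convex_on_sum[OF _ _ Phi_class_convex_on[OF assms]]) auto
  then show ?thesis
    using basis_expansion[of \<mu>] by (simp add: scalar_mult_eq_scaleR sum_divide_distrib)
qed

lemma Phi_class_ge_average_axis:
  fixes \<nu> :: "real ^ 'n \<Rightarrow> real"
  assumes "Phi_class \<nu>"
  shows "(\<Sum>k\<in>UNIV. \<nu> ((\<mu> $ k) *\<^sub>R axis k 1)) / CARD('n) \<le> \<nu> \<mu>"
  using sum_bounded_above[of UNIV "\<lambda>k. \<nu> ((\<mu> $ k) *\<^sub>R axis k 1)" "\<nu> \<mu>"]
    Phi_class_axis_le[OF assms]
  by (simp add: field_simps)

section \<open>Lower growth bound from (B)\<close>

text \<open>Semidefiniteness excludes negative eigenvalues, so the eigenvalue 0 of \<open>h\<close>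
  is an actual least element and determines the \<open>LEAST\<close>. Through this, positivity of
  \<open>lambda_min\<close> in (B) rules out null vectors.\<close>

lemma lambda_min_eq_0:
  fixes A :: "real ^ 'n ^ 'n"
  assumes psd: "\<And>v. 0 \<le> v \<bullet> (A *v v)" and h: "h \<noteq> 0" "A *v h = 0"
  shows "lambda_min A = 0"
  unfolding lambda_min_def
proof (rule Least_equality)
  show "\<exists>v. v \<noteq> 0 \<and> A *v v = 0 *\<^sub>R v" using h by auto
  fix l assume "\<exists>v. v \<noteq> 0 \<and> A *v v = l *\<^sub>R v"
  then obtain v where v: "v \<noteq> 0" "A *v v = l *\<^sub>R v" by blast
  then have "0 \<le> l * (v \<bullet> v)" using psd[of v] by simp
  then show "0 \<le> l" using v by (metis inner_gt_zero_iff not_less zero_le_mult_iff)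
qed

text \<open>The form is minimal at \<open>h\<close>, yet moving from \<open>h\<close> a little in
  the direction \<open>- A *v h\<close> would make it negative unless
  \<open>A *v h = 0\<close>.\<close>

lemma psd_symmetric_null_vector:
  fixes A :: "real ^ 'n ^ 'n"
  assumes psd: "\<And>v. 0 \<le> v \<bullet> (A *v v)" and sym: "\<And>u v. u \<bullet> (A *v v) = v \<bullet> (A *v u)"
    and h: "h \<bullet> (A *v h) = 0"
  shows "A *v h = 0"
proof -
  \<comment> \<open>The best step is \<open>w \<bullet> w / Q\<close>; adding 1 to \<open>Q\<close>
    avoids division by zero and still makes the value negative for
    \<open>w \<noteq> 0\<close>.\<close>
  define w Q s where "w = A *v h" and "Q = w \<bullet> (A *v w)" and "s = w \<bullet> w / (Q + 1)"
  have Q: "Q \<ge> 0" by (simp add: Q_def psd)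
  have "0 \<le> (h - s *\<^sub>R w) \<bullet> (A *v (h - s *\<^sub>R w))" by (rule psd)
  also have "\<dots> = s * s * Q - 2 * s * (w \<bullet> w)"
    using h sym[of h w]
    by (simp add: matrix_vector_mult_diff_distrib matrix_vector_mult_scaleR inner_simps
        flip: w_def Q_def) (simp add: algebra_simps)
  also have "\<dots> = - (s * s * (Q + 2))"
  proof -
    have "w \<bullet> w = s * (Q + 1)" using Q by (simp add: s_def)
    then show ?thesis by (simp add: algebra_simps)
  qed
  finally have "s * s * (Q + 2) \<le> 0" by simp
  moreover have "s * s * (Q + 2) > 0" if "s \<noteq> 0"
    using that Q by (metis add_nonneg_pos mult_pos_pos not_real_square_gt_zero zero_less_numeral)
  ultimately have "s = 0" by (meson not_less)
  then show ?thesis using Q by (simp add: s_def w_def add_nonneg_pos divide_eq_0_iff)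
qed

text \<open>Near 0 the Hessian at 0 is positive definite and gives quadratic growth; farther out
  convexity along rays only guarantees linear growth, hence the minimum.\<close>

lemma Phi_class_lower_bound:
  fixes \<nu> :: "real ^ 'n \<Rightarrow> real"
  assumes \<nu>: "Phi_class \<nu>"
  obtains c where "c > 0" "\<And>\<mu>. c * min ((norm \<mu>)\<^sup>2) (norm \<mu>) \<le> \<nu> \<mu>"
proof -
  define A where "A = hessian \<nu> 0"
  have G: "GDERIV \<nu> \<mu> :> grad \<nu> \<mu>" for \<mu>
    using \<nu> by (intro GDERIV_grad)
      (simp add: Phi_class_def twice_cont_differentiable_def differentiable_on_def)
  have "grad \<nu> differentiable (at 0)"
    using \<nu> by (simp add: Phi_class_def twice_cont_differentiable_def differentiable_on_def)
  then have H: "(grad \<nu> has_derivative (\<lambda>h. A *v h)) (at 0)"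
    unfolding A_def hessian_def by (simp flip: jacobian_works)
  have g0: "grad \<nu> 0 = 0" using \<nu> by (simp add: Phi_class_def)
  have taylor: "\<exists>d>0. \<forall>u. norm u < d \<longrightarrow> \<bar>\<nu> u - u \<bullet> (A *v u) / 2\<bar> \<le> e * (norm u)\<^sup>2"
    if "e > 0" for e
    using GDERIV_second_order_Taylor[OF G H that] g0 Phi_class_zero[OF \<nu>]
    by (metis add_0 diff_zero inner_zero_right)
  have sym: "u \<bullet> (A *v v) = v \<bullet> (A *v u)" for u v
    using GDERIV_second_derivative_symmetric[OF G H] .
  \<comment> \<open>As \<open>\<nu> \<ge> 0\<close>, its expansion about 0, evaluated at
    \<open>s *\<^sub>R u\<close> and divided by \<open>s\<^sup>2\<close>, makes the form nonnegative
    up to \<open>2 * e' * (norm u)\<^sup>2 \<le> e\<close>.\<close>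
  have psd: "0 \<le> u \<bullet> (A *v u)" for u
  proof (rule field_le_epsilon)
    fix e :: real assume e: "e > 0"
    define e' where "e' = e / (2 * (norm u)\<^sup>2 + 1)"
    have e': "e' > 0" using e by (simp add: e'_def add_nonneg_pos)
    then obtain d where d: "d > 0"
      "\<And>u. norm u < d \<Longrightarrow> \<bar>\<nu> u - u \<bullet> (A *v u) / 2\<bar> \<le> e' * (norm u)\<^sup>2"
      using taylor by blast
    define s where "s = d / (norm u + 1)"
    have s: "s > 0" using d by (simp add: s_def add_nonneg_pos)
    have "norm (s *\<^sub>R u) < d"
      using d by (simp add: s_def divide_less_eq add_nonneg_pos)
    from d(2)[OF this] Phi_class_nonneg[OF \<nu>, of "s *\<^sub>R u"]
    have "0 \<le> (s *\<^sub>R u) \<bullet> (A *v (s *\<^sub>R u)) / 2 + e' * (norm (s *\<^sub>R u))\<^sup>2"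
      by linarith
    also have "\<dots> = s\<^sup>2 * (u \<bullet> (A *v u) / 2 + e' * (norm u)\<^sup>2)"
      by (simp add: matrix_vector_mult_scaleR power2_eq_square algebra_simps)
    finally have "0 \<le> u \<bullet> (A *v u) / 2 + e' * (norm u)\<^sup>2"
      using s by (simp add: zero_le_mult_iff)
    moreover have "e' * (2 * (norm u)\<^sup>2 + 1) = e"
    proof -
      have "2 * (norm u)\<^sup>2 + 1 > 0" by (simp add: add_nonneg_pos)
      then have "2 * (norm u)\<^sup>2 + 1 \<noteq> 0" by (rule less_imp_neq[symmetric])
      then show ?thesis unfolding e'_def by (metis nonzero_divide_eq_eq)
    qed
    then have "2 * (e' * (norm u)\<^sup>2) \<le> e"
      using e' by (simp add: algebra_simps)
    ultimately show "0 \<le> u \<bullet> (A *v u) + e" by linarith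
  qed
  have "lambda_min A > 0"
  proof -
    have "0 < (INF \<mu>. ereal (lambda_min (hessian \<nu> \<mu>)))" using \<nu> by (simp add: Phi_class_def)
    also have "\<dots> \<le> ereal (lambda_min A)" unfolding A_def by (rule INF_lower) simp
    finally show ?thesis by simp
  qed
  \<comment> \<open>A nonzero \<open>u\<close> on which the form vanishes would be a null vector of
    \<open>A\<close>, forcing \<open>lambda_min A = 0\<close>.\<close>
  then have pos: "0 < u \<bullet> (A *v u)" if "u \<noteq> 0" for u
    using psd[of u] lambda_min_eq_0[OF psd that] psd_symmetric_null_vector[OF psd sym, of u]
    by force
  obtain u0 where u0: "norm u0 = 1" "\<And>u. norm u = 1 \<Longrightarrow> u0 \<bullet> (A *v u0) \<le> u \<bullet> (A *v u)"
  proof -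
    have "continuous_on (sphere 0 1) (\<lambda>u. u \<bullet> (A *v u))"
      by (intro continuous_intros)
    moreover have "sphere (0 :: real ^ 'n) 1 \<noteq> {}"
      by simp
    ultimately obtain u0 :: "real ^ 'n" where "u0 \<in> sphere 0 1"
        "\<forall>u\<in>sphere 0 1. u0 \<bullet> (A *v u0) \<le> u \<bullet> (A *v u)"
      using continuous_attains_inf[OF compact_sphere, of 0 1 "\<lambda>u. u \<bullet> (A *v u)"] by blast
    then show ?thesis by (intro that[of u0]) auto
  qed
  define q where "q = u0 \<bullet> (A *v u0)"
  have q: "q > 0" unfolding q_def using u0 by (intro pos) auto
  have q_le: "q * (norm u)\<^sup>2 \<le> u \<bullet> (A *v u)" for u
  proof (cases "u = 0")
    case False
    have "u \<bullet> (A *v u) = (norm u)\<^sup>2 * (sgn u \<bullet> (A *v sgn u))"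
      using False by (simp add: sgn_div_norm matrix_vector_mult_scaleR power2_eq_square field_simps)
    moreover have "q \<le> sgn u \<bullet> (A *v sgn u)"
      unfolding q_def using False by (intro u0) (simp add: norm_sgn)
    ultimately show ?thesis by (metis mult.commute mult_left_mono zero_le_power2)
  qed simp
  \<comment> \<open>Half the form is at least \<open>q / 2\<close> times the squared norm; an error
    of \<open>q / 4\<close> leaves \<open>q / 4\<close>.\<close>
  obtain d where d: "d > 0" "\<And>u. norm u < d \<Longrightarrow> \<bar>\<nu> u - u \<bullet> (A *v u) / 2\<bar> \<le> q / 4 * (norm u)\<^sup>2"
    using taylor[of "q / 4"] q by auto
  \<comment> \<open>\<open>\<delta> \<le> 1\<close> lets the single constant
    \<open>q / 4 * \<delta>\<close> serve both ranges of \<open>norm \<mu>\<close>.\<close>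
  define \<delta> where "\<delta> = min 1 (d / 2)"
  have \<delta>: "0 < \<delta>" "\<delta> \<le> 1" "\<delta> < d" using d by (auto simp: \<delta>_def min_def)
  have small: "q / 4 * (norm u)\<^sup>2 \<le> \<nu> u" if "norm u \<le> \<delta>" for u
    using d(2)[of u] q_le[of u] that \<delta> by linarith
  show ?thesis
  proof (rule that)
    show "q / 4 * \<delta> > 0" using q \<delta> by simp
    fix \<mu> :: "real ^ 'n"
    show "q / 4 * \<delta> * min ((norm \<mu>)\<^sup>2) (norm \<mu>) \<le> \<nu> \<mu>"
    proof (cases "norm \<mu> \<le> \<delta>")
      case True
      have "\<delta> * min ((norm \<mu>)\<^sup>2) (norm \<mu>) \<le> 1 * (norm \<mu>)\<^sup>2"
        using \<delta> by (intro mult_mono) auto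
      then have "q / 4 * (\<delta> * min ((norm \<mu>)\<^sup>2) (norm \<mu>)) \<le> q / 4 * (norm \<mu>)\<^sup>2"
        using q by (intro mult_left_mono) auto
      then show ?thesis using small[OF True] by (simp add: mult.assoc)
    next
      case False
      \<comment> \<open>\<open>\<mu>\<close> is pulled back to norm \<open>\<delta>\<close>, where
        the quadratic bound holds; convexity then stretches that bound linearly along the
        ray.\<close>
      define t where "t = norm \<mu> / \<delta>"
      have t: "t \<ge> 1" using False \<delta> by (simp add: t_def)
      have "q / 4 * \<delta> * min ((norm \<mu>)\<^sup>2) (norm \<mu>) \<le> q / 4 * \<delta> * norm \<mu>"
        using q \<delta> by (intro mult_left_mono) auto
      also have "\<dots> = t * (q / 4 * (norm ((1 / t) *\<^sub>R \<mu>))\<^sup>2)"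
        using False \<delta> by (simp add: t_def power2_eq_square)
      also have "\<dots> \<le> t * \<nu> ((1 / t) *\<^sub>R \<mu>)"
        using t False \<delta> by (intro mult_left_mono small) (auto simp: t_def)
      also have "\<dots> \<le> \<nu> \<mu>"
        using Phi_class_scaleR_ge[OF \<nu> t, of "(1 / t) *\<^sub>R \<mu>"] t by simp
      finally show ?thesis .
    qed
  qed
qed

section \<open>From exponential moments to the tail bound\<close>

lemma Young_Fenchel_ge:
  assumes "Phi_class \<nu>"
  shows "x \<bullet> \<mu> - \<nu> \<mu> \<le> Young_Fenchel \<nu> x"
  unfolding Young_Fenchel_def by (rule cSUP_upper[OF UNIV_I bdd_above_Young_Fenchel[OF assms]])

text \<open>This optimises Chernoff's bound over \<open>\<mu>\<close>: the infimum of the exponents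
  is minus the transform. Logarithms require \<open>p > 0\<close>; otherwise the positive right-hand
  side suffices.\<close>

lemma le_exp_minus_Young_FenchelI:
  assumes "\<And>\<mu>. p \<le> exp (\<nu> \<mu> - x \<bullet> \<mu>)"
  shows "p \<le> exp (- Young_Fenchel \<nu> x)"
proof (cases "p > 0")
  case True
  then have "x \<bullet> \<mu> - \<nu> \<mu> \<le> - ln p" for \<mu>
    using assms[of \<mu>] by (simp add: ln_ge_iff[symmetric] flip: ln_le_cancel_iff)
  then have "Young_Fenchel \<nu> x \<le> - ln p"
    unfolding Young_Fenchel_def by (intro cSUP_least) auto
  then have "ln p \<le> - Young_Fenchel \<nu> x" by linarith
  with True show ?thesis by (metis exp_le_cancel_iff exp_ln)
next
  case False
  then show ?thesis using exp_gt_zero[of "- Young_Fenchel \<nu> x"] by linarith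
qed

lemma multi_tail_le_iff:
  "multi_tail M \<xi> x \<le> p \<longleftrightarrow>
    (\<forall>s\<in>UNIV \<rightarrow> {1, -1}. measure M {\<omega> \<in> space M. \<forall>i. s i * \<xi> \<omega> $ i \<ge> x $ i} \<le> p)"
proof -
  have "(UNIV :: 'b set) \<rightarrow> {1, -1 :: real} \<noteq> {}" by auto
  then show ?thesis
    unfolding multi_tail_def by (subst Max_le_iff) (auto simp: finite_sign_vectors)
qed

lemma (in prob_space) in_Phi_space_imp_multi_tail_le:
  fixes \<nu> :: "real ^ 'n \<Rightarrow> real"
  assumes \<nu>: "Phi_class \<nu>" and \<xi>: "in_Phi_space M \<nu> \<xi>"
  shows "\<exists>C>0. \<forall>x. (\<forall>i. x $ i \<ge> 0) \<longrightarrow> multi_tail M \<xi> x \<le> exp (- Young_Fenchel \<nu> (C *\<^sub>R x))"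
proof -
  obtain \<tau>0 where \<tau>0: "\<tau>0 \<ge> 0" "\<And>\<mu>. integrable M (\<lambda>\<omega>. exp (\<mu> \<bullet> \<xi> \<omega>))"
      "\<And>\<mu>. (\<integral>\<omega>. exp (\<mu> \<bullet> \<xi> \<omega>) \<partial>M) \<le> exp (\<nu> (\<tau>0 *\<^sub>R \<mu>))"
    using \<xi> by (auto simp: in_Phi_space_def)
  \<comment> \<open>\<open>\<tau>0\<close> may be 0, whereas \<open>\<tau>\<close> is going to be
    inverted; enlarging it is harmless since \<open>\<nu>\<close> is monotone along rays.\<close>
  define \<tau> where "\<tau> = max \<tau>0 1"
  have \<tau>: "\<tau> > 0" "(\<integral>\<omega>. exp (\<mu> \<bullet> \<xi> \<omega>) \<partial>M) \<le> exp (\<nu> (\<tau> *\<^sub>R \<mu>))" for \<mu>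
    using \<tau>0 Phi_class_mono_scaleR[OF \<nu>, of \<tau>0 \<tau> \<mu>]
    by (auto simp: \<tau>_def intro: order_trans)
  define D where "D = CARD('n) * \<tau>"
  have D: "D > 0" using \<tau> by (simp add: D_def)
  show ?thesis
  proof (intro exI[of _ "1 / D"] conjI allI impI)
    show "0 < 1 / D" using D by simp
    fix x :: "real ^ 'n" assume x: "\<forall>i. x $ i \<ge> 0"
    show "multi_tail M \<xi> x \<le> exp (- Young_Fenchel \<nu> ((1 / D) *\<^sub>R x))"
      unfolding multi_tail_le_iff
    proof (intro ballI le_exp_minus_Young_FenchelI)
      fix s :: "'n \<Rightarrow> real" and \<mu> :: "real ^ 'n" assume "s \<in> UNIV \<rightarrow> {1, -1}"
      then have s: "s i = 1 \<or> s i = -1" for i by auto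
      \<comment> \<open>\<open>l\<close> takes its signs from \<open>s\<close> and not from
        \<open>\<mu>\<close>, so that \<open>l \<bullet> \<xi> \<omega> \<ge> a\<close> on the whole
        tail event.\<close>
      define l where "l = (\<chi> k. s k * \<bar>\<mu> $ k\<bar> / D)"
      define a where "a = (\<Sum>k\<in>UNIV. \<bar>\<mu> $ k\<bar> / D * x $ k)"
      have "measure M {\<omega> \<in> space M. \<forall>i. s i * \<xi> \<omega> $ i \<ge> x $ i}
          \<le> measure M {\<omega> \<in> space M. exp (l \<bullet> \<xi> \<omega>) \<ge> exp a}"
      proof (rule finite_measure_mono)
        show "{\<omega> \<in> space M. exp (l \<bullet> \<xi> \<omega>) \<ge> exp a} \<in> events"
          using borel_measurable_integrable[OF \<tau>0(2)[of l]] by measurable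
        have "a \<le> l \<bullet> y" if "\<And>i. s i * y $ i \<ge> x $ i" for y
        proof -
          have "a \<le> (\<Sum>k\<in>UNIV. \<bar>\<mu> $ k\<bar> / D * (s k * y $ k))"
            unfolding a_def using D by (intro sum_mono mult_left_mono that) auto
          also have "\<dots> = l \<bullet> y"
            by (simp add: l_def inner_vec_def algebra_simps)
          finally show ?thesis .
        qed
        then show "{\<omega> \<in> space M. \<forall>i. s i * \<xi> \<omega> $ i \<ge> x $ i}
            \<subseteq> {\<omega> \<in> space M. exp (l \<bullet> \<xi> \<omega>) \<ge> exp a}" by auto
      qed
      also have "\<dots> \<le> (\<integral>\<omega>. exp (l \<bullet> \<xi> \<omega>) \<partial>M) / exp a"
        by (rule integral_Markov_inequality_measure[OF \<tau>0(2) sets.top]) auto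
      also have "\<dots> \<le> exp (\<nu> (\<tau> *\<^sub>R l)) / exp a"
        using \<tau> by (simp add: divide_right_mono)
      also have "\<dots> \<le> exp (\<nu> \<mu> - ((1 / D) *\<^sub>R x) \<bullet> \<mu>)"
      proof -
        \<comment> \<open>\<open>D\<close> is chosen so that the coefficient on the left is
          \<open>s k * \<bar>\<mu> $ k\<bar>\<close>, whose sign is removed by evenness. The same
          axis average then lies above \<open>\<nu> (\<tau> *\<^sub>R l)\<close> and below
          \<open>\<nu> \<mu>\<close>.\<close>
        have "\<nu> ((CARD('n) * (\<tau> *\<^sub>R l) $ k) *\<^sub>R axis k 1) = \<nu> ((\<mu> $ k) *\<^sub>R axis k 1)" for k
          using s[of k] \<tau> Phi_class_axis_abs[OF \<nu>, of "\<mu> $ k" k] Phi_class_axis_abs[OF \<nu>, of "- \<bar>\<mu> $ k\<bar>" k]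
          by (auto simp: l_def D_def)
        then have "\<nu> (\<tau> *\<^sub>R l) \<le> \<nu> \<mu>"
          using Phi_class_le_average_axis[OF \<nu>, of "\<tau> *\<^sub>R l"] Phi_class_ge_average_axis[OF \<nu>, of \<mu>]
          by simp
        \<comment> \<open>Passing to absolute values of the coordinates of \<open>\<mu>\<close> only
          enlarges the linear term, because \<open>x $ i \<ge> 0\<close>.\<close>
        moreover have "((1 / D) *\<^sub>R x) \<bullet> \<mu> \<le> a"
        proof -
          have "\<mu> $ i * x $ i \<le> \<bar>\<mu> $ i\<bar> * x $ i" for i
            using x by (simp add: mult_right_mono)
          then show ?thesis
            unfolding a_def inner_vec_def using D
            by (intro sum_mono) (simp add: divide_right_mono mult.commute[of "x $ _"])
        qed
        ultimately show ?thesis by (simp flip: exp_diff)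
      qed
      finally show "measure M {\<omega> \<in> space M. \<forall>i. s i * \<xi> \<omega> $ i \<ge> x $ i}
        \<le> exp (\<nu> \<mu> - ((1 / D) *\<^sub>R x) \<bullet> \<mu>)" .
    qed
  qed
qed

section \<open>From the tail bound to exponential moments, up to a constant factor\<close>

text \<open>\<open>Y\<close> is rounded up to a natural number, whose expectation is the sum of its
  tail probabilities. The constant is 4 times the Basel sum \<open>pi\<^sup>2 / 6\<close>.\<close>

lemma (in prob_space) expectation_le_of_quadratic_tail:
  fixes Y :: "'a \<Rightarrow> real"
  assumes Y[measurable]: "Y \<in> borel_measurable M" and nonneg: "\<And>\<omega>. Y \<omega> \<ge> 0" and B: "B \<ge> 1"
    and tail: "\<And>y. y \<ge> 1 \<Longrightarrow> prob {\<omega> \<in> space M. Y \<omega> \<ge> y} \<le> B / y\<^sup>2"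
  shows "integrable M Y" "expectation Y \<le> 2 * pi\<^sup>2 / 3 * B"
proof -
  define f where "f \<omega> = nat \<lceil>Y \<omega>\<rceil>" for \<omega>
  have f: "f \<in> measurable M (count_space UNIV)" unfolding f_def by measurable
  have "(\<integral>\<^sup>+\<omega>. ennreal (Y \<omega>) \<partial>M) \<le> (\<integral>\<^sup>+\<omega>. of_nat (f \<omega>) \<partial>M)"
    by (intro nn_integral_mono)
      (auto simp: f_def ennreal_of_nat_eq_real_of_nat intro!: ennreal_leI real_nat_ceiling_ge)
  also have "\<dots> = (\<Sum>t. emeasure M {\<omega> \<in> space M. t < f \<omega>})"
    by (rule nn_integral_nat_function[OF f])
  also have "\<dots> \<le> (\<Sum>t. ennreal (4 * B * (1 / (real t + 1)\<^sup>2)))"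
  proof (intro suminf_le summableI)
    fix t :: nat
    have "prob {\<omega> \<in> space M. t < f \<omega>} \<le> 4 * B * (1 / (real t + 1)\<^sup>2)"
    \<comment> \<open>The tail hypothesis says nothing at level 0, where
      \<open>1 \<le> 4 * B\<close> is used. For \<open>t \<ge> 1\<close> the factor 4 pays for
      \<open>(t + 1) / 2 \<le> t\<close>.\<close>
    proof (cases "t = 0")
      case True
      then show ?thesis by (intro order_trans[OF prob_le_1]) (use B in simp)
    next
      case False
      have "prob {\<omega> \<in> space M. t < f \<omega>} \<le> prob {\<omega> \<in> space M. Y \<omega> \<ge> real t}"
        by (intro finite_measure_mono) (auto simp: f_def zless_nat_eq_int_zless less_ceiling_iff)
      also have "\<dots> \<le> B / (real t)\<^sup>2" using False by (intro tail) simp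
      also have "\<dots> \<le> B / ((real t + 1) / 2)\<^sup>2"
        using False B by (intro divide_left_mono power_mono mult_pos_pos) auto
      finally show ?thesis by (simp add: power_divide mult.commute[of B])
    qed
    then show "emeasure M {\<omega> \<in> space M. t < f \<omega>} \<le> ennreal (4 * B * (1 / (real t + 1)\<^sup>2))"
      by (simp add: emeasure_eq_measure ennreal_leI)
  qed
  also have "\<dots> = ennreal (4 * B * (pi\<^sup>2 / 6))"
    using sums_mult[OF inverse_squares_sums, of "4 * B"] B
    by (intro suminf_ennreal_eq) (auto simp: add.commute)
  also have "4 * B * (pi\<^sup>2 / 6) = 2 * pi\<^sup>2 / 3 * B" by simp
  finally have *: "(\<integral>\<^sup>+\<omega>. ennreal (Y \<omega>) \<partial>M) \<le> ennreal (2 * pi\<^sup>2 / 3 * B)" .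
  show "integrable M Y"
    using nonneg le_less_trans[OF * ennreal_less_top] by (intro integrableI_nonneg) auto
  then have "ennreal (expectation Y) \<le> ennreal (2 * pi\<^sup>2 / 3 * B)"
    using * nonneg by (subst (asm) nn_integral_eq_integral) auto
  then show "expectation Y \<le> 2 * pi\<^sup>2 / 3 * B" using B by (simp add: ennreal_le_iff)
qed

text \<open>At each \<open>\<omega>\<close> some sign vector makes all coordinates nonnegative, and
  off \<open>k\<close> the threshold is 0. So the sign events cover the event on the left, and a
  union bound applies.\<close>

lemma (in prob_space) prob_abs_ge_le_multi_tail:
  fixes \<xi> :: "'a \<Rightarrow> real ^ 'n"
  assumes [measurable]: "\<xi> \<in> borel_measurable M" and "t \<ge> 0"
  shows "prob {\<omega> \<in> space M. \<bar>\<xi> \<omega> $ k\<bar> \<ge> t}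
    \<le> card ((UNIV :: 'n set) \<rightarrow> {1, -1 :: real}) * multi_tail M \<xi> (t *\<^sub>R axis k 1)"
proof -
  define S where "S = (UNIV :: 'n set) \<rightarrow> {1, -1 :: real}"
  define E where "E s = {\<omega> \<in> space M. \<forall>i. s i * \<xi> \<omega> $ i \<ge> (t *\<^sub>R axis k 1 :: real ^ 'n) $ i}" for s
  have fin: "finite S" unfolding S_def by (rule finite_sign_vectors)
  have E: "E s \<in> events" for s unfolding E_def by measurable
  have "{\<omega> \<in> space M. \<bar>\<xi> \<omega> $ k\<bar> \<ge> t} \<subseteq> (\<Union>s\<in>S. E s)"
  proof
    fix \<omega> assume \<omega>: "\<omega> \<in> {\<omega> \<in> space M. \<bar>\<xi> \<omega> $ k\<bar> \<ge> t}"
    define s where "s i = (if \<xi> \<omega> $ i \<ge> 0 then 1 else -1 :: real)" for i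
    have "s i * \<xi> \<omega> $ i = \<bar>\<xi> \<omega> $ i\<bar>" for i by (simp add: s_def)
    then have "\<omega> \<in> E s" using \<omega> by (auto simp: E_def axis_def)
    moreover have "s \<in> S" by (auto simp: S_def s_def)
    ultimately show "\<omega> \<in> (\<Union>s\<in>S. E s)" by blast
  qed
  then have "prob {\<omega> \<in> space M. \<bar>\<xi> \<omega> $ k\<bar> \<ge> t} \<le> prob (\<Union>s\<in>S. E s)"
    using fin E by (intro finite_measure_mono) auto
  also have "\<dots> \<le> (\<Sum>s\<in>S. prob (E s))"
    using fin E by (intro measure_UNION_le) auto
  also have "\<dots> \<le> card S * multi_tail M \<xi> (t *\<^sub>R axis k 1)"
    using multi_tail_le_iff[of M \<xi> "t *\<^sub>R axis k 1"]
    by (intro sum_bounded_above) (auto simp: E_def S_def)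
  finally show ?thesis by (simp add: S_def)
qed

text \<open>The sum is at most \<open>CARD('n)\<close> times its largest term, which already occurs
  on the right. This reduces joint exponential moments to those of single coordinates.\<close>

lemma exp_sum_le_sum_exp:
  fixes b :: "'n::finite \<Rightarrow> real"
  shows "exp (\<Sum>k\<in>UNIV. b k) \<le> (\<Sum>k\<in>UNIV. exp (CARD('n) * b k))"
proof -
  have "Max (range b) \<in> range b" by (rule Max_in) auto
  then obtain k where "Max (range b) = b k" by blast
  then have k: "b i \<le> b k" for i using Max_ge[of "range b" "b i"] by simp
  have "(\<Sum>i\<in>UNIV. b i) \<le> CARD('n) * b k"
    using sum_bounded_above[of UNIV b "b k"] k by simp
  then have "exp (\<Sum>i\<in>UNIV. b i) \<le> exp (CARD('n) * b k)" by simp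
  also have "\<dots> \<le> (\<Sum>k\<in>UNIV. exp (CARD('n) * b k))"
    by (rule member_le_sum) auto
  finally show ?thesis .
qed

lemma exp_le_1_plus_quadratic: "exp x \<le> 1 + x + x\<^sup>2 / 2 * exp \<bar>x\<bar>" for x :: real
proof -
  obtain t where t: "\<bar>t\<bar> \<le> \<bar>x\<bar>" "exp x = (\<Sum>m<2. x ^ m / fact m) + exp t / fact 2 * x ^ 2"
    using Maclaurin_exp_le[of x 2] by blast
  have "(\<Sum>m<2. x ^ m / fact m) = 1 + x" by (simp add: numeral_2_eq_2)
  with t(2) have "exp x = 1 + x + x\<^sup>2 / 2 * exp t" by simp
  moreover have "x\<^sup>2 / 2 * exp t \<le> x\<^sup>2 / 2 * exp \<bar>x\<bar>" using t(1) by (intro mult_left_mono) auto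
  ultimately show ?thesis by linarith
qed

lemma borel_measurable_vec_nth_compose [measurable (raw)]:
  fixes f :: "'a \<Rightarrow> real ^ 'n"
  assumes "f \<in> borel_measurable M"
  shows "(\<lambda>\<omega>. f \<omega> $ k) \<in> borel_measurable M"
  unfolding cart_eq_inner_axis using assms by (intro borel_measurable_inner) auto

lemma (in prob_space) multi_tail_le_imp_coordinate_exp_moment:
  fixes \<xi> :: "'a \<Rightarrow> real ^ 'n"
  assumes \<nu>: "Phi_class \<nu>" and \<xi>[measurable]: "\<xi> \<in> borel_measurable M" and C: "C > 0"
    and tail: "\<And>x. \<forall>i. x $ i \<ge> 0 \<Longrightarrow> multi_tail M \<xi> x \<le> exp (- Young_Fenchel \<nu> (C *\<^sub>R x))"
  obtains K where "K \<ge> 1" "\<And>l k. l \<ge> 0 \<Longrightarrow> integrable M (\<lambda>\<omega>. exp (l * \<bar>\<xi> \<omega> $ k\<bar>))"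
    "\<And>l k. l \<ge> 0 \<Longrightarrow> expectation (\<lambda>\<omega>. exp (l * \<bar>\<xi> \<omega> $ k\<bar>)) \<le> K * exp (\<nu> ((2 * l / C) *\<^sub>R axis k 1))"
proof -
  define N where "N = card ((UNIV :: 'n set) \<rightarrow> {1, -1 :: real})"
  have "(\<lambda>_. 1) \<in> (UNIV :: 'n set) \<rightarrow> {1, -1 :: real}" by auto
  then have N: "N \<ge> 1"
    unfolding N_def using finite_sign_vectors[where 'n = 'n]
    by (metis One_nat_def Suc_leI card_gt_0_iff empty_iff)
  have pi: "2 * pi\<^sup>2 / 3 \<ge> 1"
    using pi_gt3 power_mono[of 3 pi 2] by simp
  define K where "K = 2 * pi\<^sup>2 / 3 * N"
  have K: "K \<ge> 1" unfolding K_def using pi N mult_mono[of 1 "2 * pi\<^sup>2 / 3" 1 "real N"] by simp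
  have *: "integrable M (\<lambda>\<omega>. exp (l * \<bar>\<xi> \<omega> $ k\<bar>)) \<and>
      expectation (\<lambda>\<omega>. exp (l * \<bar>\<xi> \<omega> $ k\<bar>)) \<le> K * exp (\<nu> ((2 * l / C) *\<^sub>R axis k 1))"
    if l: "l \<ge> 0" for l k
  proof (cases "l = 0")
    case True
    then show ?thesis using K by (simp add: Phi_class_zero[OF \<nu>] prob_space)
  next
    case False
    define B where "B = N * exp (\<nu> ((2 * l / C) *\<^sub>R axis k 1))"
    have B: "B \<ge> 1"
      unfolding B_def using N Phi_class_nonneg[OF \<nu>] mult_mono[of 1 "real N" 1 "exp (\<nu> ((2 * l / C) *\<^sub>R axis k 1))"]
      by simp
    have "prob {\<omega> \<in> space M. exp (l * \<bar>\<xi> \<omega> $ k\<bar>) \<ge> y} \<le> B / y\<^sup>2" if y: "y \<ge> 1" for y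
    proof -
      define t where "t = ln y / l"
      have t: "t \<ge> 0" using y l by (simp add: t_def)
      have ly: "ln y = l * t" using False by (simp add: t_def)
      have "exp (l * \<bar>\<xi> \<omega> $ k\<bar>) \<ge> y \<longleftrightarrow> \<bar>\<xi> \<omega> $ k\<bar> \<ge> t" for \<omega>
      proof -
        have "exp (l * \<bar>\<xi> \<omega> $ k\<bar>) \<ge> y \<longleftrightarrow> l * t \<le> l * \<bar>\<xi> \<omega> $ k\<bar>"
          using y unfolding ly[symmetric] by (metis exp_le_cancel_iff exp_ln less_le_trans zero_less_one)
        then show ?thesis using l False by simp
      qed
      then have "prob {\<omega> \<in> space M. exp (l * \<bar>\<xi> \<omega> $ k\<bar>) \<ge> y} = prob {\<omega> \<in> space M. \<bar>\<xi> \<omega> $ k\<bar> \<ge> t}"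
        by simp
      also have "\<dots> \<le> N * multi_tail M \<xi> (t *\<^sub>R axis k 1)"
        unfolding N_def by (rule prob_abs_ge_le_multi_tail[OF \<xi> t])
      also have "\<dots> \<le> N * exp (- Young_Fenchel \<nu> (C *\<^sub>R t *\<^sub>R axis k 1))"
        using t by (intro mult_left_mono tail) (auto simp: axis_def)
      \<comment> \<open>Testing the supremum at \<open>(2 * l / C) *\<^sub>R axis k 1\<close>
        produces \<open>exp (- 2 * l * t)\<close>, the inverse square of \<open>y\<close>; the
        factor 2 is what makes the tail summable.\<close>
      also have "\<dots> \<le> N * exp (\<nu> ((2 * l / C) *\<^sub>R axis k 1) - 2 * (l * t))"
      proof -
        have "(C *\<^sub>R t *\<^sub>R axis k 1) \<bullet> ((2 * l / C) *\<^sub>R axis k 1 :: real ^ 'n) = 2 * (l * t)"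
          using C by (simp add: inner_axis_axis)
        then show ?thesis
          using Young_Fenchel_ge[OF \<nu>, of "C *\<^sub>R t *\<^sub>R axis k 1" "(2 * l / C) *\<^sub>R axis k 1"]
          by (intro mult_left_mono) auto
      qed
      also have "\<dots> = B / y\<^sup>2"
      proof -
        have "exp (2 * (l * t)) = y\<^sup>2"
          using y by (simp add: ly[symmetric] exp_double)
        then show ?thesis by (simp add: B_def exp_diff)
      qed
      finally show ?thesis .
    qed
    note * = expectation_le_of_quadratic_tail[OF _ exp_ge_zero B this]
    have "integrable M (\<lambda>\<omega>. exp (l * \<bar>\<xi> \<omega> $ k\<bar>))" by (rule *) measurable
    moreover have "expectation (\<lambda>\<omega>. exp (l * \<bar>\<xi> \<omega> $ k\<bar>)) \<le> 2 * pi\<^sup>2 / 3 * B" by (rule *) measurable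
    ultimately show ?thesis by (simp add: K_def B_def mult.assoc)
  qed
  show ?thesis by (rule that[OF K]) (use * in blast)+
qed

text \<open>With absolute values the exponent dominates
  \<open>\<mu> \<bullet> \<xi> \<omega>\<close> and, when all coordinates of \<open>\<mu>\<close>
  are 2, also \<open>2 * norm (\<xi> \<omega>)\<close>; both are needed later.\<close>

lemma (in prob_space) multi_tail_le_imp_exp_moment:
  fixes \<xi> :: "'a \<Rightarrow> real ^ 'n"
  assumes \<nu>: "Phi_class \<nu>" and \<xi>[measurable]: "\<xi> \<in> borel_measurable M" and C: "C > 0"
    and tail: "\<And>x. \<forall>i. x $ i \<ge> 0 \<Longrightarrow> multi_tail M \<xi> x \<le> exp (- Young_Fenchel \<nu> (C *\<^sub>R x))"
  obtains K \<tau> where "K \<ge> 1" "\<tau> > 0"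
    "\<And>\<mu>. integrable M (\<lambda>\<omega>. exp (\<Sum>k\<in>UNIV. \<bar>\<mu> $ k\<bar> * \<bar>\<xi> \<omega> $ k\<bar>))"
    "\<And>\<mu>. expectation (\<lambda>\<omega>. exp (\<Sum>k\<in>UNIV. \<bar>\<mu> $ k\<bar> * \<bar>\<xi> \<omega> $ k\<bar>)) \<le> K * exp (\<nu> (\<tau> *\<^sub>R \<mu>))"
proof -
  obtain K where K: "K \<ge> 1" and int: "\<And>l k. l \<ge> 0 \<Longrightarrow> integrable M (\<lambda>\<omega>. exp (l * \<bar>\<xi> \<omega> $ k\<bar>))"
    and le: "\<And>l k. l \<ge> 0 \<Longrightarrow> expectation (\<lambda>\<omega>. exp (l * \<bar>\<xi> \<omega> $ k\<bar>)) \<le> K * exp (\<nu> ((2 * l / C) *\<^sub>R axis k 1))"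
    using multi_tail_le_imp_coordinate_exp_moment[OF \<nu> \<xi> C tail] by blast
  define d where "d = real CARD('n)"
  have d: "d \<ge> 1" by (simp add: d_def Suc_leI)
  \<comment> \<open>The factor \<open>d\<close> comes from splitting the exponential of the sum,
    \<open>2 / C\<close> from the coordinate moments.\<close>
  define \<tau> where "\<tau> = 2 * d / C"
  have \<tau>: "\<tau> > 0" using C d by (simp add: \<tau>_def)
  have *: "integrable M (\<lambda>\<omega>. exp (\<Sum>k\<in>UNIV. \<bar>\<mu> $ k\<bar> * \<bar>\<xi> \<omega> $ k\<bar>)) \<and>
      expectation (\<lambda>\<omega>. exp (\<Sum>k\<in>UNIV. \<bar>\<mu> $ k\<bar> * \<bar>\<xi> \<omega> $ k\<bar>)) \<le> d * K * exp (\<nu> (\<tau> *\<^sub>R \<mu>))" for \<mu>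
  proof -
    let ?S = "\<lambda>\<omega>. \<Sum>k\<in>UNIV. exp (d * \<bar>\<mu> $ k\<bar> * \<bar>\<xi> \<omega> $ k\<bar>)"
    have bound: "exp (\<Sum>k\<in>UNIV. \<bar>\<mu> $ k\<bar> * \<bar>\<xi> \<omega> $ k\<bar>) \<le> ?S \<omega>" for \<omega>
      using exp_sum_le_sum_exp[of "\<lambda>k. \<bar>\<mu> $ k\<bar> * \<bar>\<xi> \<omega> $ k\<bar>"] by (simp add: d_def mult.assoc)
    have intk: "integrable M (\<lambda>\<omega>. exp (d * \<bar>\<mu> $ k\<bar> * \<bar>\<xi> \<omega> $ k\<bar>))" for k
      using d by (intro int) auto
    then have intS: "integrable M ?S" by (intro Bochner_Integration.integrable_sum)
    have intE: "integrable M (\<lambda>\<omega>. exp (\<Sum>k\<in>UNIV. \<bar>\<mu> $ k\<bar> * \<bar>\<xi> \<omega> $ k\<bar>))"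
    proof (rule Bochner_Integration.integrable_bound[OF intS])
      show "(\<lambda>\<omega>. exp (\<Sum>k\<in>UNIV. \<bar>\<mu> $ k\<bar> * \<bar>\<xi> \<omega> $ k\<bar>)) \<in> borel_measurable M" by measurable
    qed (use bound in \<open>auto intro: order_trans[OF _ abs_ge_self]\<close>)
    have "expectation (\<lambda>\<omega>. exp (\<Sum>k\<in>UNIV. \<bar>\<mu> $ k\<bar> * \<bar>\<xi> \<omega> $ k\<bar>)) \<le> expectation ?S"
      by (rule integral_mono[OF intE intS bound])
    also have "\<dots> = (\<Sum>k\<in>UNIV. expectation (\<lambda>\<omega>. exp (d * \<bar>\<mu> $ k\<bar> * \<bar>\<xi> \<omega> $ k\<bar>)))"
      using intk by simp
    also have "\<dots> \<le> (\<Sum>k\<in>(UNIV :: 'n set). K * exp (\<nu> (\<tau> *\<^sub>R \<mu>)))"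
    proof (rule sum_mono)
      fix k
      have "expectation (\<lambda>\<omega>. exp (d * \<bar>\<mu> $ k\<bar> * \<bar>\<xi> \<omega> $ k\<bar>))
          \<le> K * exp (\<nu> ((2 * (d * \<bar>\<mu> $ k\<bar>) / C) *\<^sub>R axis k 1))"
        using d by (intro le) auto
      also have "2 * (d * \<bar>\<mu> $ k\<bar>) / C = \<bar>(\<tau> *\<^sub>R \<mu>) $ k\<bar>"
        using \<tau> by (simp add: \<tau>_def abs_mult) (use C d in simp)
      also have "\<nu> (\<bar>(\<tau> *\<^sub>R \<mu>) $ k\<bar> *\<^sub>R axis k 1) \<le> \<nu> (\<tau> *\<^sub>R \<mu>)"
        unfolding Phi_class_axis_abs[OF \<nu>] by (rule Phi_class_axis_le[OF \<nu>])
      finally show "expectation (\<lambda>\<omega>. exp (d * \<bar>\<mu> $ k\<bar> * \<bar>\<xi> \<omega> $ k\<bar>)) \<le> K * exp (\<nu> (\<tau> *\<^sub>R \<mu>))"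
        using K by simp
    qed
    finally show ?thesis using intE by (simp add: d_def)
  qed
  have "d * K \<ge> 1" using d K mult_mono[of 1 d 1 K] by simp
  show ?thesis by (rule that[OF \<open>d * K \<ge> 1\<close> \<tau>]) (use * in blast)+
qed

section \<open>Absorbing the constant factor\<close>

lemma inner_le_sum_abs: "\<mu> \<bullet> y \<le> (\<Sum>k\<in>UNIV. \<bar>\<mu> $ k\<bar> * \<bar>y $ k\<bar>)" for y :: "real ^ 'n"
  unfolding inner_vec_def by (intro sum_mono) (simp flip: abs_mult)

text \<open>Centering removes the linear term of the expansion, and \<open>1 + z \<le> exp z\<close>
  turns the rest into a bound with no constant in front.\<close>

lemma (in prob_space) centered_exp_moment_near_0:
  assumes "centered M \<eta>" and int: "\<And>\<mu>. integrable M (\<lambda>\<omega>. exp (\<mu> \<bullet> \<eta> \<omega>))"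
    and int2: "integrable M (\<lambda>\<omega>. exp (2 * norm (\<eta> \<omega>)))" and \<mu>: "norm \<mu> \<le> 1"
  shows "expectation (\<lambda>\<omega>. exp (\<mu> \<bullet> \<eta> \<omega>))
    \<le> exp (expectation (\<lambda>\<omega>. exp (2 * norm (\<eta> \<omega>))) * (norm \<mu>)\<^sup>2)"
proof -
  have \<eta>: "integrable M \<eta>" "expectation \<eta> = 0" using assms by (auto simp: centered_def)
  let ?E = "expectation (\<lambda>\<omega>. exp (2 * norm (\<eta> \<omega>)))"
  have "expectation (\<lambda>\<omega>. exp (\<mu> \<bullet> \<eta> \<omega>))
      \<le> expectation (\<lambda>\<omega>. 1 + \<mu> \<bullet> \<eta> \<omega> + (norm \<mu>)\<^sup>2 * exp (2 * norm (\<eta> \<omega>)))"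
  proof (rule integral_mono)
    fix \<omega>
    define r x where "r = norm (\<eta> \<omega>)" and "x = \<mu> \<bullet> \<eta> \<omega>"
    have x: "\<bar>x\<bar> \<le> norm \<mu> * r" unfolding x_def r_def by (rule Cauchy_Schwarz_ineq2)
    have "norm \<mu> * r \<le> 1 * r" using \<mu> by (intro mult_right_mono) (auto simp: r_def)
    with x have "exp \<bar>x\<bar> \<le> exp r" by simp
    moreover have "x\<^sup>2 \<le> (norm \<mu>)\<^sup>2 * r\<^sup>2"
      using power_mono[OF x, of 2] by (simp add: power_mult_distrib)
    ultimately have "x\<^sup>2 * exp \<bar>x\<bar> \<le> (norm \<mu>)\<^sup>2 * r\<^sup>2 * exp r"
      by (intro mult_mono) auto
    \<comment> \<open>The factor \<open>r\<^sup>2\<close> is absorbed into a second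
      \<open>exp r\<close>, so the moment of \<open>exp (2 * r)\<close> suffices.\<close>
    also have "\<dots> \<le> (norm \<mu>)\<^sup>2 * (2 * exp r) * exp r"
    proof -
      have "r \<ge> 0" by (simp add: r_def)
      then have "r\<^sup>2 \<le> 2 * exp r" using exp_lower_Taylor_quadratic[of r] by linarith
      then show ?thesis by (intro mult_right_mono mult_left_mono) auto
    qed
    also have "\<dots> = 2 * ((norm \<mu>)\<^sup>2 * exp (2 * r))" by (simp add: exp_double power2_eq_square)
    finally show "exp (\<mu> \<bullet> \<eta> \<omega>) \<le> 1 + \<mu> \<bullet> \<eta> \<omega> + (norm \<mu>)\<^sup>2 * exp (2 * norm (\<eta> \<omega>))"
      using exp_le_1_plus_quadratic[of x] unfolding r_def x_def by simp
  qed (use int int2 \<eta> in auto)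
  also have "\<dots> = 1 + (norm \<mu>)\<^sup>2 * ?E"
    using int2 \<eta> by (simp add: prob_space)
  also have "\<dots> \<le> exp (?E * (norm \<mu>)\<^sup>2)"
    using exp_ge_add_one_self[of "?E * (norm \<mu>)\<^sup>2"] by (simp add: mult.commute)
  finally show ?thesis .
qed

lemma (in prob_space) multi_tail_le_imp_in_Phi_space:
  fixes \<xi> :: "'a \<Rightarrow> real ^ 'n"
  assumes \<nu>: "Phi_class \<nu>" and \<xi>: "centered M \<xi>" and C: "C > 0"
    and tail: "\<And>x. \<forall>i. x $ i \<ge> 0 \<Longrightarrow> multi_tail M \<xi> x \<le> exp (- Young_Fenchel \<nu> (C *\<^sub>R x))"
  shows "in_Phi_space M \<nu> \<xi>"
proof -
  have meas[measurable]: "\<xi> \<in> borel_measurable M" using \<xi> by (auto simp: centered_def)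
  obtain K \<tau>1 where K: "K \<ge> 1" and \<tau>1: "\<tau>1 > 0"
    and int': "\<And>\<mu>. integrable M (\<lambda>\<omega>. exp (\<Sum>k\<in>UNIV. \<bar>\<mu> $ k\<bar> * \<bar>\<xi> \<omega> $ k\<bar>))"
    and le': "\<And>\<mu>. expectation (\<lambda>\<omega>. exp (\<Sum>k\<in>UNIV. \<bar>\<mu> $ k\<bar> * \<bar>\<xi> \<omega> $ k\<bar>)) \<le> K * exp (\<nu> (\<tau>1 *\<^sub>R \<mu>))"
    using multi_tail_le_imp_exp_moment[OF \<nu> meas C tail] by blast
  have int: "integrable M (\<lambda>\<omega>. exp (\<mu> \<bullet> \<xi> \<omega>))" for \<mu>
    by (rule Bochner_Integration.integrable_bound[OF int'[of \<mu>]]) (auto simp: inner_le_sum_abs)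
  have le: "expectation (\<lambda>\<omega>. exp (\<mu> \<bullet> \<xi> \<omega>)) \<le> K * exp (\<nu> (\<tau>1 *\<^sub>R \<mu>))" for \<mu>
    using integral_mono[OF int[of \<mu>] int'[of \<mu>]] le'[of \<mu>] by (force simp: inner_le_sum_abs)
  have int2: "integrable M (\<lambda>\<omega>. exp (2 * norm (\<xi> \<omega>)))"
  proof (rule Bochner_Integration.integrable_bound[OF int'[of "\<chi> k. 2"]])
    show "AE \<omega> in M. norm (exp (2 * norm (\<xi> \<omega>)))
        \<le> norm (exp (\<Sum>k\<in>UNIV. \<bar>(\<chi> k::'n. (2::real)) $ k\<bar> * \<bar>\<xi> \<omega> $ k\<bar>))"
      using norm_le_l1_cart by (auto simp flip: sum_distrib_left)
  qed simp
  define E where "E = expectation (\<lambda>\<omega>. exp (2 * norm (\<xi> \<omega>)))"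
  obtain c where c: "c > 0" "\<And>\<mu>. c * min ((norm \<mu>)\<^sup>2) (norm \<mu>) \<le> \<nu> \<mu>"
    using Phi_class_lower_bound[OF \<nu>] by blast
  \<comment> \<open>\<open>m\<close> bounds \<open>\<nu> (\<tau>1 *\<^sub>R \<mu>)\<close> from
    below for \<open>norm \<mu> > 1\<close>.\<close>
  define m where "m = c * min (\<tau>1\<^sup>2) \<tau>1"
  have m: "m > 0" using c \<tau>1 by (simp add: m_def)
  \<comment> \<open>\<open>E / c\<close> makes \<open>\<nu>\<close> beat the quadratic exponent
    inside the unit ball. Outside it, \<open>1 + ln K / m\<close> absorbs \<open>K\<close>, since
    \<open>ln K \<le> ln K / m * v\<close> once \<open>v \<ge> m\<close>.\<close>
  define \<tau> where "\<tau> = max 1 (max (E / c) (\<tau>1 * (1 + ln K / m)))"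
  have \<tau>: "\<tau> \<ge> 1" "E / c \<le> \<tau>" "\<tau>1 * (1 + ln K / m) \<le> \<tau>"
    by (simp_all add: \<tau>_def)
  have E_le: "E \<le> c * \<tau>"
    using \<tau>(2) c(1) by (metis mult.commute pos_divide_le_eq)
  have "expectation (\<lambda>\<omega>. exp (\<mu> \<bullet> \<xi> \<omega>)) \<le> exp (\<nu> (\<tau> *\<^sub>R \<mu>))" for \<mu>
  proof (cases "norm \<mu> \<le> 1")
    case True
    have "E * (norm \<mu>)\<^sup>2 \<le> c * \<tau> * (norm \<mu>)\<^sup>2"
      using E_le by (intro mult_right_mono) auto
    also have "\<dots> \<le> c * min ((norm (\<tau> *\<^sub>R \<mu>))\<^sup>2) (norm (\<tau> *\<^sub>R \<mu>))"
    proof -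
      \<comment> \<open>Both arguments of the minimum are at least
        \<open>\<tau> * (norm \<mu>)\<^sup>2\<close>: the first because
        \<open>\<tau> \<ge> 1\<close>, the second because \<open>norm \<mu> \<le> 1\<close>.\<close>
      have "\<tau> * (norm \<mu>)\<^sup>2 \<le> \<tau>\<^sup>2 * (norm \<mu>)\<^sup>2"
        using \<tau> by (intro mult_right_mono) (auto simp: self_le_power)
      moreover have "\<tau> * (norm \<mu>)\<^sup>2 \<le> \<tau> * norm \<mu>"
        using \<tau> True by (intro mult_left_mono) (auto simp: power2_eq_square mult_left_le)
      ultimately show ?thesis
        using c \<tau> by (simp add: mult.assoc power_mult_distrib)
    qed
    also have "\<dots> \<le> \<nu> (\<tau> *\<^sub>R \<mu>)" by (rule c)
    finally have "exp (E * (norm \<mu>)\<^sup>2) \<le> exp (\<nu> (\<tau> *\<^sub>R \<mu>))" by simp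
    then show ?thesis
      using centered_exp_moment_near_0[OF \<xi> int int2 True] unfolding E_def by linarith
  next
    case False
    define v where "v = \<nu> (\<tau>1 *\<^sub>R \<mu>)"
    have "m \<le> c * min ((norm (\<tau>1 *\<^sub>R \<mu>))\<^sup>2) (norm (\<tau>1 *\<^sub>R \<mu>))"
      unfolding m_def using c \<tau>1 False by (intro mult_left_mono min.mono) auto
    also have "\<dots> \<le> v" unfolding v_def by (rule c)
    finally have v: "m \<le> v" .
    have lnK: "0 \<le> ln K / m" using K m by simp
    have "ln K \<le> ln K / m * v"
      using mult_left_mono[OF v lnK] m by simp
    then have "ln K + v \<le> (1 + ln K / m) * v" by (simp add: algebra_simps)
    also have "\<dots> \<le> \<nu> ((1 + ln K / m) *\<^sub>R \<tau>1 *\<^sub>R \<mu>)"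
      unfolding v_def using lnK by (intro Phi_class_scaleR_ge[OF \<nu>]) simp
    also have "\<dots> \<le> \<nu> (\<tau> *\<^sub>R \<mu>)"
      using Phi_class_mono_scaleR[OF \<nu>, of "\<tau>1 * (1 + ln K / m)" \<tau> \<mu>] \<tau> \<tau>1 lnK
      by (simp add: mult.commute)
    finally have "exp (ln K + v) \<le> exp (\<nu> (\<tau> *\<^sub>R \<mu>))" by simp
    then show ?thesis using le[of \<mu>] K by (simp add: exp_add v_def)
  qed
  then show ?thesis
    using \<xi> int \<tau> unfolding in_Phi_space_def by (intro conjI exI[of _ \<tau>]) auto
qed

theorem theorem7p2:
  fixes M :: "'a measure"
    and \<nu> :: "real ^ 'n \<Rightarrow> real"
    and \<xi> :: "'a \<Rightarrow> real ^ 'n"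
  assumes "prob_space M"
    and "Phi_class \<nu>"
    and "centered M \<xi>"
    and "\<not> (AE \<omega> in M. \<xi> \<omega> = 0)"
  shows "in_Phi_space M \<nu> \<xi> \<longleftrightarrow>
    (\<exists>C>0. \<forall>x. (\<forall>i. x $ i \<ge> 0) \<longrightarrow> multi_tail M \<xi> x \<le> exp (- Young_Fenchel \<nu> (C *\<^sub>R x)))"
proof -
  interpret prob_space M by fact
  show ?thesis
    using in_Phi_space_imp_multi_tail_le[OF assms(2)]
      multi_tail_le_imp_in_Phi_space[OF assms(2,3)] by blast
qed

end
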